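(* Let $(\boldsymbol{X},\boldsymbol{T})$ be a nonautonomous dynamical system, let $K\subset X_0$ be a non-empty compact subset, and let $\boldsymbol{f}\in\boldsymbol{C}(\boldsymbol{X},\mathbb{R})$. (1) Suppose $\underline{P}(\boldsymbol{T},\boldsymbol{f},K\cap V)=\underline{P}(\boldsymbol{T},\boldsymbol{f},K)$ for all open sets $V\subset X_0$ such that $V\cap K\neq\emptyset$. Then $$\underline{P}(\boldsymbol{T},\boldsymbol{f},K)=\inf\Big\{\sup_{i=1,2,\ldots}\underline{P}(\boldsymbol{T},\boldsymbol{f},F_i):\ \bigcup_{i=1}^{\infty}F_i\supset K\Big\}.$$ (2) Suppose $\overline{P}(\boldsymbol{T},\boldsymbol{f},K\cap V)=\overline{P}(\boldsymbol{T},\boldsymbol{f},K)$ for all open sets $V\subset X_0$ such that $V\cap K\neq\emptyset$. Then $$\overline{P}(\boldsymbol{T},\boldsymbol{f},K)=\inf\Big\{\sup_{i=1,2,\ldots}\overline{P}(\boldsymbol{T},\boldsymbol{f},F_i):\ \bigcup_{i=1}^{\infty}F_i\supset K\Big\}.$$ In both cases the infimum is over all countable families $\{F_i\}_{i=1}^\infty$ of subsets of $X_0$ covering $K$.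
   Context: A nonautonomous dynamical system (NDS) $(\boldsymbol{X},\boldsymbol{T})$ consists of a sequence $\boldsymbol{X}=\{X_k\}_{k=0}^\infty$ of compact metric spaces $(X_k,d_k)$ and a sequence $\boldsymbol{T}=\{T_k\}_{k=0}^\infty$ of continuous maps $T_k:X_k\to X_{k+1}$. Write $\boldsymbol{T}^0=\mathrm{id}_{X_0}$ and $\boldsymbol{T}^j=T_{j-1}\circ\cdots\circ T_0:X_0\to X_j$. For $n\ge 1$ the $n$-th Bowen metric on $X_0$ is $d_n^{\boldsymbol{T}}(x,y)=\max_{0\le j\le n-1}d_j(\boldsymbol{T}^jx,\boldsymbol{T}^jy)$. $\boldsymbol{C}(\boldsymbol{X},\mathbb{R})=\prod_{k\ge 0}C(X_k,\mathbb{R})$ is the set of sequences $\boldsymbol{f}=\{f_k\}_{k=0}^\infty$ of continuous functions $f_k:X_k\to\mathbb{R}$, and $S_n^{\boldsymbol{T}}\boldsymbol{f}=\sum_{j=0}^{n-1}f_j\circ\boldsymbol{T}^j$. For $Z\subset X_0$, $n\ge 1$, $\varepsilon>0$: a set $E\subset Z$ is $(n,\varepsilon)$-separated for $Z$ if $d_n^{\boldsymbol{T}}(x,y)>\varepsilon$ for all distinct $x,y\in E$. Put $$P_n(\boldsymbol{T},\boldsymbol{f},Z,\varepsilon)=\sup\Big\{\sum_{x\in E}e^{S_n^{\boldsymbol{T}}\boldsymbol{f}(x)}:E\text{ is an }(n,\varepsilon)\text{-separated set for }Z\Big\},$$ $\underline{P}(\boldsymbol{T},\boldsymbol{f},Z,\varepsilon)=\liminf_{n\to\infty}\frac1n\log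 P_n(\boldsymbol{T},\boldsymbol{f},Z,\varepsilon)$, $\overline{P}(\boldsymbol{T},\boldsymbol{f},Z,\varepsilon)=\limsup_{n\to\infty}\frac1n\log P_n(\boldsymbol{T},\boldsymbol{f},Z,\varepsilon)$ (with $\log 0=-\infty$). These are non-increasing in $\varepsilon$, and $\underline{P}(\boldsymbol{T},\boldsymbol{f},Z)=\lim_{\varepsilon\to0}\underline{P}(\boldsymbol{T},\boldsymbol{f},Z,\varepsilon)$, $\overline{P}(\boldsymbol{T},\boldsymbol{f},Z)=\lim_{\varepsilon\to0}\overline{P}(\boldsymbol{T},\boldsymbol{f},Z,\varepsilon)$, with values in $\mathbb{R}\cup\{\pm\infty\}$. *)

theory Defs
  imports "HOL-Analysis.Analysis"
begin

text \<open>
  The spaces of a nonautonomous system vary with time.  They are all represented as metric spaces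
  over one common carrier type; since a sequence of spaces can always be realised inside its disjoint
  union, this loses no generality.  The spaces need not be related inside that type.  Values of the
  maps and potentials outside the respective space are irrelevant.
\<close>

definition nds :: "(nat \<Rightarrow> 'a metric) \<Rightarrow> (nat \<Rightarrow> 'a \<Rightarrow> 'a) \<Rightarrow> bool" where
  "nds X T \<longleftrightarrow>
     (\<forall>k. compact_space (mtopology_of (X k))) \<and>
     (\<forall>k. continuous_map (mtopology_of (X k)) (mtopology_of (X (Suc k))) (T k))"

definition potential :: "(nat \<Rightarrow> 'a metric) \<Rightarrow> (nat \<Rightarrow> 'a \<Rightarrow> real) \<Rightarrow> bool" where
  "potential X f \<longleftrightarrow> (\<forall>k. continuous_map (mtopology_of (X k)) euclideanreal (f k))"

primrec nds_iter :: "(nat \<Rightarrow> 'a \<Rightarrow> 'a) \<Rightarrow> nat \<Rightarrow> 'a \<Rightarrow> 'a" where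
  "nds_iter T 0 = id"
| "nds_iter T (Suc j) = T j \<circ> nds_iter T j"

text \<open>Meaningful for \<open>n \<ge> 1\<close> only, as are the notions built on it.\<close>

definition bowen_dist ::
    "(nat \<Rightarrow> 'a metric) \<Rightarrow> (nat \<Rightarrow> 'a \<Rightarrow> 'a) \<Rightarrow> nat \<Rightarrow> 'a \<Rightarrow> 'a \<Rightarrow> real" where
  "bowen_dist X T n x y = (MAX j\<in>{..<n}. mdist (X j) (nds_iter T j x) (nds_iter T j y))"

definition birkhoff_sum ::
    "(nat \<Rightarrow> 'a \<Rightarrow> 'a) \<Rightarrow> (nat \<Rightarrow> 'a \<Rightarrow> real) \<Rightarrow> nat \<Rightarrow> 'a \<Rightarrow> real" where
  "birkhoff_sum T f n x = (\<Sum>j<n. f j (nds_iter T j x))"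

definition separated_for ::
    "(nat \<Rightarrow> 'a metric) \<Rightarrow> (nat \<Rightarrow> 'a \<Rightarrow> 'a) \<Rightarrow> nat \<Rightarrow> real \<Rightarrow> 'a set \<Rightarrow> 'a set \<Rightarrow> bool" where
  "separated_for X T n \<epsilon> Z E \<longleftrightarrow>
     E \<subseteq> Z \<and> (\<forall>x\<in>E. \<forall>y\<in>E. x \<noteq> y \<longrightarrow> bowen_dist X T n x y > \<epsilon>)"

definition log_ereal :: "ereal \<Rightarrow> ereal" where
  "log_ereal a = (case a of ereal r \<Rightarrow> if r > 0 then ereal (ln r) else - \<infinity> | PInfty \<Rightarrow> \<infinity> | MInfty \<Rightarrow> - \<infinity>)"

text \<open>
  Separated sets are finite by compactness (lemma \<open>finite_separated_for\<close> below), so the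
  sum never takes the default value \<open>0\<close> that it has on infinite sets.
\<close>

definition P_sep ::
    "(nat \<Rightarrow> 'a metric) \<Rightarrow> (nat \<Rightarrow> 'a \<Rightarrow> 'a) \<Rightarrow> (nat \<Rightarrow> 'a \<Rightarrow> real) \<Rightarrow> 'a set \<Rightarrow> nat \<Rightarrow> real \<Rightarrow> ereal" where
  "P_sep X T f Z n \<epsilon> =
     (SUP E\<in>{E. separated_for X T n \<epsilon> Z E}. ereal (\<Sum>x\<in>E. exp (birkhoff_sum T f n x)))"

definition lower_pressure_at ::
    "(nat \<Rightarrow> 'a metric) \<Rightarrow> (nat \<Rightarrow> 'a \<Rightarrow> 'a) \<Rightarrow> (nat \<Rightarrow> 'a \<Rightarrow> real) \<Rightarrow> 'a set \<Rightarrow> real \<Rightarrow> ereal" where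
  "lower_pressure_at X T f Z \<epsilon> =
     liminf (\<lambda>n. ereal (1 / real n) * log_ereal (P_sep X T f Z n \<epsilon>))"

definition upper_pressure_at ::
    "(nat \<Rightarrow> 'a metric) \<Rightarrow> (nat \<Rightarrow> 'a \<Rightarrow> 'a) \<Rightarrow> (nat \<Rightarrow> 'a \<Rightarrow> real) \<Rightarrow> 'a set \<Rightarrow> real \<Rightarrow> ereal" where
  "upper_pressure_at X T f Z \<epsilon> =
     limsup (\<lambda>n. ereal (1 / real n) * log_ereal (P_sep X T f Z n \<epsilon>))"

definition lower_pressure ::
    "(nat \<Rightarrow> 'a metric) \<Rightarrow> (nat \<Rightarrow> 'a \<Rightarrow> 'a) \<Rightarrow> (nat \<Rightarrow> 'a \<Rightarrow> real) \<Rightarrow> 'a set \<Rightarrow> ereal" where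
  "lower_pressure X T f Z = Lim (at_right 0) (\<lambda>\<epsilon>. lower_pressure_at X T f Z \<epsilon>)"

definition upper_pressure ::
    "(nat \<Rightarrow> 'a metric) \<Rightarrow> (nat \<Rightarrow> 'a \<Rightarrow> 'a) \<Rightarrow> (nat \<Rightarrow> 'a \<Rightarrow> real) \<Rightarrow> 'a set \<Rightarrow> ereal" where
  "upper_pressure X T f Z = Lim (at_right 0) (\<lambda>\<epsilon>. upper_pressure_at X T f Z \<epsilon>)"

definition countable_covers :: "(nat \<Rightarrow> 'a metric) \<Rightarrow> 'a set \<Rightarrow> (nat \<Rightarrow> 'a set) set" where
  "countable_covers X K = {F. (\<forall>i. F i \<subseteq> mspace (X 0)) \<and> K \<subseteq> (\<Union>i. F i)}"

lemma continuous_map_nds_iter: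
  assumes "nds X T"
  shows "continuous_map (mtopology_of (X 0)) (mtopology_of (X j)) (nds_iter T j)"
proof (induction j)
  case 0
  then show ?case by simp
next
  case (Suc j)
  then show ?case
    using assms continuous_map_compose[OF Suc.IH, of "mtopology_of (X (Suc j))" "T j"]
    unfolding nds_iter.simps(2) nds_def by blast
qed

lemma finite_separated_for:
  assumes nds: "nds X T" and n: "n \<ge> 1" and eps: "\<epsilon> > 0"
    and Z: "Z \<subseteq> mspace (X 0)" and E: "separated_for X T n \<epsilon> Z E"
  shows "finite E"
proof -
  let ?X = "mspace (X 0)"
  define B where "B j a = Metric_space.mball (mspace (X j)) (mdist (X j)) a (\<epsilon> / 2)" for j a
  define U where
    "U x = {y \<in> ?X. \<forall>j\<in>{..<n}. nds_iter T j y \<in> B j (nds_iter T j x)}" for x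
  have in_B: "z \<in> B j a \<longleftrightarrow> a \<in> mspace (X j) \<and> z \<in> mspace (X j) \<and> mdist (X j) a z < \<epsilon> / 2"
    for z j a
    by (simp add: B_def Metric_space.in_mball)
  have memX: "nds_iter T j x \<in> mspace (X j)" if "x \<in> ?X" for j x
    using continuous_map_nds_iter[OF nds, of j] that by (auto simp: continuous_map_def)
  have openU: "openin (mtopology_of (X 0)) (U x)" if "x \<in> ?X" for x
  proof -
    have "openin (mtopology_of (X j)) (B j a)" for j a
      unfolding B_def mtopology_of_def
      by (simp add: Metric_space.openin_mball)
    then have *: "openin (mtopology_of (X 0)) {y \<in> ?X. nds_iter T j y \<in> B j (nds_iter T j x)}" for j
      using openin_continuous_map_preimage[OF continuous_map_nds_iter[OF nds, of j]] by simp
    have "U x = (\<Inter>j\<in>{..<n}. {y \<in> ?X. nds_iter T j y \<in> B j (nds_iter T j x)})"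
    proof -
      have "0 \<in> {..<n}" using n by simp
      then show ?thesis unfolding U_def by blast
    qed
    moreover have "openin (mtopology_of (X 0))
        (\<Inter>j\<in>{..<n}. {y \<in> ?X. nds_iter T j y \<in> B j (nds_iter T j x)})"
      using n * by (intro openin_INT2) (auto simp: lessThan_empty_iff)
    ultimately show ?thesis by simp
  qed
  have selfU: "x \<in> U x" if x: "x \<in> ?X" for x
  proof -
    have "nds_iter T j x \<in> B j (nds_iter T j x)" for j
      unfolding B_def using eps memX[OF x]
      by (intro Metric_space.centre_in_mball_iff[OF Metric_space_mspace_mdist, THEN iffD2]) auto
    then show ?thesis using x by (simp add: U_def)
  qed
  have "compactin (mtopology_of (X 0)) ?X"
    using nds by (simp add: nds_def compact_space_def)
  moreover have "\<forall>V \<in> U ` ?X. openin (mtopology_of (X 0)) V" using openU by auto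
  moreover have "?X \<subseteq> \<Union>(U ` ?X)" using selfU by auto
  ultimately obtain \<F> where F: "finite \<F>" "\<F> \<subseteq> U ` ?X" "?X \<subseteq> \<Union>\<F>"
    unfolding compactin_def by blast
  have single: "finite (E \<inter> V)" if "V \<in> \<F>" for V
  proof -
    from that F(2) obtain x where x: "x \<in> ?X" "V = U x" by auto
    have uniq: "y = z" if yz: "y \<in> E \<inter> V" "z \<in> E \<inter> V" for y z
    proof (rule ccontr)
      assume "y \<noteq> z"
      then have "bowen_dist X T n y z > \<epsilon>" using E yz by (auto simp: separated_for_def)
      moreover have "mdist (X j) (nds_iter T j y) (nds_iter T j z) < \<epsilon>" if "j < n" for j
      proof -
        have "nds_iter T j y \<in> B j (nds_iter T j x)" "nds_iter T j z \<in> B j (nds_iter T j x)"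
          using yz x that by (auto simp: U_def)
        then show ?thesis
          using mdist_triangle[of "nds_iter T j y" "X j" "nds_iter T j x" "nds_iter T j z"]
          by (auto simp: in_B mdist_commute)
      qed
      then have "bowen_dist X T n y z < \<epsilon>"
        unfolding bowen_dist_def using n by (subst Max_less_iff) (auto simp: lessThan_empty_iff)
      ultimately show False by simp
    qed
    show ?thesis
    proof (cases "E \<inter> V = {}")
      case False
      then obtain y where y: "y \<in> E \<inter> V" by auto
      have "E \<inter> V \<subseteq> {y}"
      proof
        fix z assume "z \<in> E \<inter> V"
        from uniq[OF this y] show "z \<in> {y}" by simp
      qed
      then show ?thesis by (rule finite_subset) simp
    qed simp
  qed
  have "E \<subseteq> (\<Union>V\<in>\<F>. E \<inter> V)"
  proof
    fix y assume y: "y \<in> E"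
    then have "y \<in> ?X" using E Z by (auto simp: separated_for_def)
    with F(3) obtain V where "V \<in> \<F>" "y \<in> V" by auto
    with y show "y \<in> (\<Union>V\<in>\<F>. E \<inter> V)" by auto
  qed
  moreover have "finite (\<Union>V\<in>\<F>. E \<inter> V)" by (rule finite_UN_I[OF F(1) single])
  ultimately show ?thesis by (rule finite_subset)
qed

end

theory Submission
  imports Defs
begin

text \<open>
  The pressure of a set equals that of its closure: separation by a strict inequality is an open
  condition on finite sets, so a finite separated subset of the closure can be moved into the set
  itself, changing the Birkhoff sums by arbitrarily little.  Given a countable cover of the compact
  set, by the Baire category theorem the closure of one member contains a relatively open piece of
  the compact set, and by hypothesis that piece already carries the full pressure.
\<close>

section \<open>Pressures as suprema over the scale, and their monotonicity\<close>

text \<open>\<open>Lim\<close> is a definite description, so its value is known only once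
  convergence is proved. This turns the limit \<epsilon> -> 0 in the pressures into a supremum, on
  which monotonicity and equality in the set argument can be checked scale by scale.\<close>

lemma Lim_at_right_antimono:
  fixes g :: "real \<Rightarrow> 'b::{complete_linorder, linorder_topology}"
  assumes anti: "\<And>x y. a < x \<Longrightarrow> x \<le> y \<Longrightarrow> g y \<le> g x"
  shows "Lim (at_right a) g = (SUP x\<in>{a<..}. g x)"
proof (rule tendsto_Lim)
  show "(g \<longlongrightarrow> (SUP x\<in>{a<..}. g x)) (at_right a)"
  proof (rule order_tendstoI)
    fix c assume "c < (SUP x\<in>{a<..}. g x)"
    then obtain b where b: "a < b" "c < g b"
      by (auto simp: less_SUP_iff)
    \<comment> \<open>The point \<open>b\<close> bounds the neighbourhood: \<open>g x\<close> is at
      least \<open>g b\<close> for all \<open>x\<close> in \<open>(a, b)\<close>.\<close>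
    show "eventually (\<lambda>x. c < g x) (at_right a)"
      unfolding eventually_at_right_field
      using b anti by (meson less_imp_le less_le_trans)
  next
    fix c assume c: "(SUP x\<in>{a<..}. g x) < c"
    have "g x < c" if "a < x" for x
      using SUP_upper[of x "{a<..}" g] c that by auto
    then show "eventually (\<lambda>x. g x < c) (at_right a)"
      unfolding eventually_at_right_field by (metis gt_ex)
  qed
qed simp

lemma log_ereal_mono:
  assumes "a \<le> b"
  shows "log_ereal a \<le> log_ereal b"
  using assms by (cases a; cases b) (auto simp: log_ereal_def)

text \<open>The factor is nonnegative for every \<open>n\<close>; at \<open>n = 0\<close> it is
  \<open>0\<close>, as \<open>1 / 0 = 0\<close>, so both sides vanish there.\<close>

lemma scaled_log_ereal_mono:
  assumes "a \<le> b"
  shows "ereal (1 / real n) * log_ereal a \<le> ereal (1 / real n) * log_ereal b"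
  by (intro ereal_mult_left_mono log_ereal_mono assms) simp

lemma P_sep_mono:
  assumes "Z \<subseteq> Z'" and "\<epsilon>' \<le> \<epsilon>"
  shows "P_sep X T f Z n \<epsilon> \<le> P_sep X T f Z' n \<epsilon>'"
proof -
  have "{E. separated_for X T n \<epsilon> Z E} \<subseteq> {E. separated_for X T n \<epsilon>' Z' E}"
    using assms by (fastforce simp: separated_for_def)
  then show ?thesis
    unfolding P_sep_def by (rule SUP_subset_mono) simp
qed

lemma lower_pressure_at_mono:
  assumes "Z \<subseteq> Z'" and "\<epsilon>' \<le> \<epsilon>"
  shows "lower_pressure_at X T f Z \<epsilon> \<le> lower_pressure_at X T f Z' \<epsilon>'"
  unfolding lower_pressure_at_def
  by (intro Liminf_mono always_eventually allI scaled_log_ereal_mono P_sep_mono assms)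

lemma upper_pressure_at_mono:
  assumes "Z \<subseteq> Z'" and "\<epsilon>' \<le> \<epsilon>"
  shows "upper_pressure_at X T f Z \<epsilon> \<le> upper_pressure_at X T f Z' \<epsilon>'"
  unfolding upper_pressure_at_def
  by (intro Limsup_mono always_eventually allI scaled_log_ereal_mono P_sep_mono assms)

lemma lower_pressure_eq_SUP:
  "lower_pressure X T f Z = (SUP \<epsilon>\<in>{0<..}. lower_pressure_at X T f Z \<epsilon>)"
  unfolding lower_pressure_def
  by (intro Lim_at_right_antimono lower_pressure_at_mono order_refl)

lemma upper_pressure_eq_SUP:
  "upper_pressure X T f Z = (SUP \<epsilon>\<in>{0<..}. upper_pressure_at X T f Z \<epsilon>)"
  unfolding upper_pressure_def
  by (intro Lim_at_right_antimono upper_pressure_at_mono order_refl)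

lemma lower_pressure_mono: "Z \<subseteq> Z' \<Longrightarrow> lower_pressure X T f Z \<le> lower_pressure X T f Z'"
  unfolding lower_pressure_eq_SUP by (intro SUP_mono' lower_pressure_at_mono order_refl)

lemma upper_pressure_mono: "Z \<subseteq> Z' \<Longrightarrow> upper_pressure X T f Z \<le> upper_pressure X T f Z'"
  unfolding upper_pressure_eq_SUP by (intro SUP_mono' upper_pressure_at_mono order_refl)

section \<open>Invariance of the pressure under closure\<close>

lemma tendsto_mdist:
  assumes u: "limitin (mtopology_of m) u a F" and v: "limitin (mtopology_of m) v b F"
  shows "((\<lambda>i. mdist m (u i) (v i)) \<longlongrightarrow> mdist m a b) F"
proof -
  have "limitin (prod_topology (mtopology_of m) (mtopology_of m)) (\<lambda>i. (u i, v i)) (a, b) F"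
    using u v by (simp add: limitin_pairwise o_def)
  moreover have "continuous_map (prod_topology (mtopology_of m) (mtopology_of m)) euclideanreal
      (\<lambda>p. mdist m (fst p) (snd p))"
    by (intro continuous_map_mdist continuous_map_fst continuous_map_snd)
  ultimately show ?thesis
    using continuous_map_limit by (fastforce simp: o_def)
qed

text \<open>The maximum over a finite nonempty set of times is attained, so a single time witnesses
  that two points are separated.\<close>

lemma bowen_dist_greater_iff:
  assumes "n \<ge> 1"
  shows "c < bowen_dist X T n x y \<longleftrightarrow>
    (\<exists>j<n. c < mdist (X j) (nds_iter T j x) (nds_iter T j y))"
  unfolding bowen_dist_def using assms
  by (subst Max_gr_iff) (auto simp: lessThan_empty_iff)

lemma limitin_nds_iter:
  assumes "nds X T" and "limitin (mtopology_of (X 0)) u x F"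
  shows "limitin (mtopology_of (X j)) (\<lambda>i. nds_iter T j (u i)) (nds_iter T j x) F"
  using continuous_map_limit[OF continuous_map_nds_iter[OF assms(1)] assms(2)]
  by (simp add: o_def)

lemma tendsto_birkhoff_sum:
  assumes nds: "nds X T" and f: "potential X f" and u: "limitin (mtopology_of (X 0)) u x F"
  shows "((\<lambda>i. birkhoff_sum T f n (u i)) \<longlongrightarrow> birkhoff_sum T f n x) F"
  unfolding birkhoff_sum_def
proof (rule tendsto_sum)
  fix j
  show "((\<lambda>i. f j (nds_iter T j (u i))) \<longlongrightarrow> f j (nds_iter T j x)) F"
    using continuous_map_limit[OF f[unfolded potential_def, rule_format] limitin_nds_iter[OF nds u]]
    by (simp add: o_def)
qed

text \<open>Equality holds for each fixed \<open>n\<close> and \<epsilon>, with no change of scale: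
  the moved set is separated at the same \<epsilon>, and the supremum over \<open>Z\<close> absorbs
  the loss in the sums.\<close>

lemma P_sep_closure_of:
  assumes nds: "nds X T" and f: "potential X f" and n: "n \<ge> 1" and eps: "\<epsilon> > 0"
    and Z: "Z \<subseteq> mspace (X 0)"
  shows "P_sep X T f (mtopology_of (X 0) closure_of Z) n \<epsilon> = P_sep X T f Z n \<epsilon>"
proof (rule antisym)
  let ?C = "mtopology_of (X 0) closure_of Z"
  let ?w = "\<lambda>x. exp (birkhoff_sum T f n x)"
  show "P_sep X T f ?C n \<epsilon> \<le> P_sep X T f Z n \<epsilon>"
    unfolding P_sep_def[of X T f ?C]
  proof (rule SUP_least)
    fix E assume "E \<in> {E. separated_for X T n \<epsilon> ?C E}"
    then have sep: "separated_for X T n \<epsilon> ?C E"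
      by simp
    have "?C \<subseteq> mspace (X 0)"
      using closure_of_subset_topspace[of "mtopology_of (X 0)" Z] by simp
    then have fin: "finite E"
      using finite_separated_for[OF nds n eps _ sep] by blast
    have "\<exists>\<sigma>. (\<forall>m. \<sigma> m \<in> Z) \<and> limitin (mtopology_of (X 0)) \<sigma> x sequentially" if "x \<in> E" for x
    proof -
      have "x \<in> ?C"
        using sep that by (auto simp: separated_for_def)
      then show ?thesis
        unfolding mtopology_of_def Metric_space.closure_of_sequentially[OF Metric_space_mspace_mdist]
        by auto
    qed
    then obtain s where sZ: "\<And>x m. x \<in> E \<Longrightarrow> s x m \<in> Z"
      and lim: "\<And>x. x \<in> E \<Longrightarrow> limitin (mtopology_of (X 0)) (s x) x sequentially"
      by metis
    have pair: "\<forall>\<^sub>F m in sequentially. bowen_dist X T n (s x m) (s y m) > \<epsilon>"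
      if xy: "x \<in> E" "y \<in> E" "x \<noteq> y" for x y
    proof -
      have "bowen_dist X T n x y > \<epsilon>"
        using sep xy by (auto simp: separated_for_def)
      \<comment> \<open>At this one time the distance of the moved points converges to a value above
        \<epsilon>, so it eventually exceeds \<epsilon>.\<close>
      then obtain j where j: "j < n" "\<epsilon> < mdist (X j) (nds_iter T j x) (nds_iter T j y)"
        unfolding bowen_dist_greater_iff[OF n] by blast
      have "(\<lambda>m. mdist (X j) (nds_iter T j (s x m)) (nds_iter T j (s y m)))
          \<longlonglongrightarrow> mdist (X j) (nds_iter T j x) (nds_iter T j y)"
        by (intro tendsto_mdist limitin_nds_iter[OF nds] lim xy)
      from order_tendstoD(1)[OF this j(2)] show ?thesis
        by (rule eventually_mono) (use j(1) in \<open>auto simp: bowen_dist_greater_iff[OF n]\<close>)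
    qed
    \<comment> \<open>Since \<open>E\<close> is finite, one index \<open>m\<close> eventually serves
      all pairs at once.\<close>
    have ev: "\<forall>\<^sub>F m in sequentially.
        \<forall>x\<in>E. \<forall>y\<in>E. x \<noteq> y \<longrightarrow> bowen_dist X T n (s x m) (s y m) > \<epsilon>"
    proof (intro eventually_ball_finite fin ballI)
      fix x y assume "x \<in> E" "y \<in> E"
      then show "\<forall>\<^sub>F m in sequentially. x \<noteq> y \<longrightarrow> bowen_dist X T n (s x m) (s y m) > \<epsilon>"
        by (cases "x = y") (simp_all add: pair)
    qed
    have le: "\<forall>\<^sub>F m in sequentially. ereal (\<Sum>x\<in>E. ?w (s x m)) \<le> P_sep X T f Z n \<epsilon>"
    proof (rule eventually_mono[OF ev])
      fix m
      assume m: "\<forall>x\<in>E. \<forall>y\<in>E. x \<noteq> y \<longrightarrow> bowen_dist X T n (s x m) (s y m) > \<epsilon>"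
      \<comment> \<open>Separated images therefore cannot coincide. So moving \<open>E\<close> is
        injective, and the sum over the image has one term for each point of
        \<open>E\<close>.\<close>
      have diag: "\<not> bowen_dist X T n z z > \<epsilon>" if "z \<in> Z" for z
      proof -
        have "nds_iter T j z \<in> mspace (X j)" for j
          using continuous_map_nds_iter[OF nds, of j] that Z by (auto simp: continuous_map_def)
        then show ?thesis
          using eps by (simp add: bowen_dist_greater_iff[OF n]
              Metric_space.mdist_zero[OF Metric_space_mspace_mdist])
      qed
      have inj: "inj_on (\<lambda>x. s x m) E"
      proof (rule inj_onI, rule ccontr)
        fix x y assume xy: "x \<in> E" "y \<in> E" "s x m = s y m" "x \<noteq> y"
        with m diag[OF sZ[OF xy(1)]] show False
          by metis
      qed
      have "separated_for X T n \<epsilon> Z ((\<lambda>x. s x m) ` E)"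
        using m sZ by (auto simp: separated_for_def)
      then have "ereal (\<Sum>z\<in>(\<lambda>x. s x m) ` E. ?w z) \<le> P_sep X T f Z n \<epsilon>"
        unfolding P_sep_def by (intro SUP_upper) simp
      then show "ereal (\<Sum>x\<in>E. ?w (s x m)) \<le> P_sep X T f Z n \<epsilon>"
        by (simp add: sum.reindex[OF inj])
    qed
    \<comment> \<open>The bound in \<open>le\<close> does not depend on \<open>m\<close>, hence it
      passes to the limit.\<close>
    have "(\<lambda>m. \<Sum>x\<in>E. ?w (s x m)) \<longlonglongrightarrow> (\<Sum>x\<in>E. ?w x)"
      by (intro tendsto_sum tendsto_exp tendsto_birkhoff_sum[OF nds f] lim)
    then have "(\<lambda>m. ereal (\<Sum>x\<in>E. ?w (s x m))) \<longlonglongrightarrow> ereal (\<Sum>x\<in>E. ?w x)"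
      by (rule tendsto_ereal)
    from tendsto_upperbound[OF this le] show "ereal (\<Sum>x\<in>E. ?w x) \<le> P_sep X T f Z n \<epsilon>"
      by simp
  qed
  show "P_sep X T f Z n \<epsilon> \<le> P_sep X T f ?C n \<epsilon>"
    using Z by (intro P_sep_mono closure_of_subset) auto
qed

lemma
  assumes nds: "nds X T" and f: "potential X f" and Z: "Z \<subseteq> mspace (X 0)"
  shows lower_pressure_closure_of:
      "lower_pressure X T f (mtopology_of (X 0) closure_of Z) = lower_pressure X T f Z"
    and upper_pressure_closure_of:
      "upper_pressure X T f (mtopology_of (X 0) closure_of Z) = upper_pressure X T f Z"
proof -
  let ?C = "mtopology_of (X 0) closure_of Z"
  \<comment> \<open>The equality of \<open>P_sep\<close> is available for \<open>n \<ge> 1\<close>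
    only, which suffices for a lower or upper limit.\<close>
  have ev: "\<forall>\<^sub>F n in sequentially. ereal (1 / real n) * log_ereal (P_sep X T f ?C n \<epsilon>) =
      ereal (1 / real n) * log_ereal (P_sep X T f Z n \<epsilon>)" if "\<epsilon> > 0" for \<epsilon>
    using eventually_ge_at_top[of 1] by eventually_elim (simp add: P_sep_closure_of[OF nds f _ that Z])
  show "lower_pressure X T f ?C = lower_pressure X T f Z"
    unfolding lower_pressure_eq_SUP lower_pressure_at_def
    by (intro SUP_cong refl Liminf_eq ev) simp
  show "upper_pressure X T f ?C = upper_pressure X T f Z"
    unfolding upper_pressure_eq_SUP upper_pressure_at_def
    by (intro SUP_cong refl Limsup_eq ev) simp
qed

section \<open>Baire category and the variational formula\<close>

text \<open>The subspace \<open>K\<close> is compact Hausdorff, hence locally compact and regular,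
  so Baire's theorem applies in it. The closed traces \<open>?G i\<close> fill \<open>K\<close>; if
  all had empty interior, so would the nonempty space \<open>K\<close> itself.\<close>

lemma Baire_countable_cover:
  assumes "Hausdorff_space Y" and K: "compactin Y K" "K \<noteq> {}"
    and cover: "K \<subseteq> (\<Union>i::nat. F i)" and F: "\<And>i. F i \<subseteq> topspace Y"
  obtains i V where "openin Y V" "V \<inter> K \<noteq> {}" "K \<inter> V \<subseteq> Y closure_of (F i)"
proof -
  let ?S = "subtopology Y K"
  let ?G = "\<lambda>i. Y closure_of (F i) \<inter> K"
  have KY: "K \<subseteq> topspace Y"
    using K compactin_subset_topspace by blast
  have cpt: "compact_space ?S"
    using K by (simp add: compact_space_subtopology)
  have "regular_space ?S"
    using assms(1) cpt by (intro compact_Hausdorff_imp_regular_space Hausdorff_space_subtopology)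
  have closed: "closedin ?S (?G i)" for i
    using closedin_closure_of[of Y "F i"] unfolding closedin_subtopology by (intro exI conjI) simp_all
  have "\<exists>i. ?S interior_of ?G i \<noteq> {}"
  proof (rule ccontr)
    assume "\<not> ?thesis"
    then have "?S interior_of \<Union>(range ?G) = {}"
      using cpt \<open>regular_space ?S\<close>
      by (intro Baire_category_alt)
         (auto simp: compact_imp_locally_compact_space closed)
    moreover have "\<Union>(range ?G) = topspace ?S"
      using cover F KY closure_of_subset[OF F] by fastforce
    ultimately show False
      using KY K(2) interior_of_topspace[of ?S] by (simp add: Int_absorb1)
  qed
  then obtain i where i: "?S interior_of ?G i \<noteq> {}"
    by blast
  \<comment> \<open>The interior is open only relative to \<open>K\<close>; \<open>V\<close> is an
    open set of \<open>Y\<close> that cuts it out.\<close>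
  obtain V where V: "openin Y V" "?S interior_of ?G i = V \<inter> K"
    using openin_interior_of[of ?S "?G i"] unfolding openin_subtopology by blast
  then show ?thesis
    using that[of V i] i interior_of_subset[of ?S "?G i"] by auto
qed

text \<open>Abstracting \<open>P\<close> lets one argument serve both pressures, through three
  properties: monotonicity, invariance under closure, and full value on every open piece of
  \<open>K\<close>.\<close>

lemma INF_SUP_countable_covers:
  fixes P :: "'a set \<Rightarrow> ereal"
  assumes K: "compactin (mtopology_of (X 0)) K" "K \<noteq> {}"
    and mono: "\<And>A B. A \<subseteq> B \<Longrightarrow> P A \<le> P B"
    and closure: "\<And>A. A \<subseteq> mspace (X 0) \<Longrightarrow> P (mtopology_of (X 0) closure_of A) = P A"
    and local: "\<And>V. openin (mtopology_of (X 0)) V \<Longrightarrow> V \<inter> K \<noteq> {} \<Longrightarrow> P (K \<inter> V) = P K"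
  shows "P K = (INF F\<in>countable_covers X K. SUP i. P (F i))"
proof (rule antisym)
  show "P K \<le> (INF F\<in>countable_covers X K. SUP i. P (F i))"
  proof (rule INF_greatest)
    fix F assume "F \<in> countable_covers X K"
    then have F: "\<And>i. F i \<subseteq> mspace (X 0)" "K \<subseteq> (\<Union>i. F i)"
      by (auto simp: countable_covers_def)
    have "Hausdorff_space (mtopology_of (X 0))"
      unfolding mtopology_of_def
      by (rule Metric_space.Hausdorff_space_mtopology[OF Metric_space_mspace_mdist])
    then obtain i V where V: "openin (mtopology_of (X 0)) V" "V \<inter> K \<noteq> {}"
      and sub: "K \<inter> V \<subseteq> mtopology_of (X 0) closure_of (F i)"
      using Baire_countable_cover K F by (metis topspace_mtopology_of)
    have "P K = P (K \<inter> V)"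
      using local[OF V] by simp
    also have "\<dots> \<le> P (F i)"
      using mono[OF sub] closure[OF F(1)] by simp
    also have "\<dots> \<le> (SUP i. P (F i))"
      by (rule SUP_upper) simp
    finally show "P K \<le> (SUP i. P (F i))" .
  qed
  \<comment> \<open>The constant family covers \<open>K\<close> and its supremum is
    \<open>P K\<close>, which bounds the infimum from above.\<close>
  have "(\<lambda>i. K) \<in> countable_covers X K"
    using compactin_subset_topspace[OF K(1)] by (simp add: countable_covers_def)
  from INF_lower[OF this, of "\<lambda>F. SUP i. P (F i)"]
  show "(INF F\<in>countable_covers X K. SUP i. P (F i)) \<le> P K"
    by simp
qed

theorem theorem4p6:
  fixes X :: "nat \<Rightarrow> 'a metric" and T :: "nat \<Rightarrow> 'a \<Rightarrow> 'a"
    and f :: "nat \<Rightarrow> 'a \<Rightarrow> real" and K :: "'a set"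
  assumes "nds X T"
    and "compactin (mtopology_of (X 0)) K" and "K \<noteq> {}"
    and "potential X f"
  shows "((\<forall>V. openin (mtopology_of (X 0)) V \<and> V \<inter> K \<noteq> {} \<longrightarrow>
              lower_pressure X T f (K \<inter> V) = lower_pressure X T f K) \<longrightarrow>
            lower_pressure X T f K =
              (INF F\<in>countable_covers X K. SUP i. lower_pressure X T f (F i))) \<and>
         ((\<forall>V. openin (mtopology_of (X 0)) V \<and> V \<inter> K \<noteq> {} \<longrightarrow>
              upper_pressure X T f (K \<inter> V) = upper_pressure X T f K) \<longrightarrow>
            upper_pressure X T f K =
              (INF F\<in>countable_covers X K. SUP i. upper_pressure X T f (F i)))"
proof (intro conjI impI)
  assume "\<forall>V. openin (mtopology_of (X 0)) V \<and> V \<inter> K \<noteq> {} \<longrightarrow>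
      lower_pressure X T f (K \<inter> V) = lower_pressure X T f K"
  then show "lower_pressure X T f K =
      (INF F\<in>countable_covers X K. SUP i. lower_pressure X T f (F i))"
    by (intro INF_SUP_countable_covers[where X = X] assms(2,3) lower_pressure_mono
        lower_pressure_closure_of[OF assms(1,4)]) simp_all
next
  assume "\<forall>V. openin (mtopology_of (X 0)) V \<and> V \<inter> K \<noteq> {} \<longrightarrow>
      upper_pressure X T f (K \<inter> V) = upper_pressure X T f K"
  then show "upper_pressure X T f K =
      (INF F\<in>countable_covers X K. SUP i. upper_pressure X T f (F i))"
    by (intro INF_SUP_countable_covers[where X = X] assms(2,3) upper_pressure_mono
        upper_pressure_closure_of[OF assms(1,4)]) simp_all
qed

end
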